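(* Let $G$ and $G'$ be finite abelian groups with $|G|=|G'|$ and normalized character tables $\mathcal{C}$ and $\mathcal{C}'$ respectively. Then the set of $(G,G')$-transformation matrices is $$\left\{\mathcal{C}^\dagger P^\pi\mathcal{C}' : \pi:\widehat{G'}\to\widehat{G}\text{ a bijection}\right\}.$$ In particular, this set is finite.
   Context: $\widehat{G}$ denotes the group of (complex, degree one) characters of $G$. The normalized character table $\mathcal{C}$ of $G$ is the matrix with rows indexed by $\widehat{G}$, columns indexed by $G$, and $(\chi,a)$-entry $\frac{1}{\sqrt{|G|}}\chi(a)$. For a bijection $\pi:\widehat{G'}\to\widehat{G}$, $P^\pi$ is the $\widehat{G}\times\widehat{G'}$ permutation matrix with $P^\pi_{x,y}=1$ if $x=\pi(y)$ and $0$ otherwise. A matrix $U\in\mathbb{C}^{G\times G'}$ (rows indexed by $G$, columns by $G'$) is a $(G,G')$-transformation matrix if (1) $U$ is unitary; (2) $\overline{U_{a,b}}=U_{a^{-1},b^{-1}}$ for all $a\in G$, $b\in G'$; and (3) $U_{ab,c}=\sum_{x,y\in G',\,xy=c}U_{a,x}U_{b,y}$ for all $a,b\in G$, $c\in G'$. *)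

theory Defs
  imports Complex_Main "HOL-Algebra.Multiplicative_Group"
begin

text \<open>A complex matrix with rows indexed by \<open>I\<close> and columns indexed by \<open>J\<close> is an extensional
  function on \<open>I \<times> J\<close> (value \<open>undefined\<close> outside), so that equality of functions is
  equality of matrices and sets of matrices have their true cardinality.\<close>

type_synonym ('i, 'j) cmatrix = "'i \<times> 'j \<Rightarrow> complex"

definition matrices :: "'i set \<Rightarrow> 'j set \<Rightarrow> ('i, 'j) cmatrix set" where
  "matrices I J = (I \<times> J \<rightarrow>\<^sub>E UNIV)"

definition mk_matrix :: "'i set \<Rightarrow> 'j set \<Rightarrow> ('i \<Rightarrow> 'j \<Rightarrow> complex) \<Rightarrow> ('i, 'j) cmatrix" where
  "mk_matrix I J f = (\<lambda>(i, j) \<in> I \<times> J. f i j)"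

text \<open>The index sets are explicit parameters: in \<open>matrix_mult I K J A B\<close>, \<open>A\<close> is an
  \<open>I \<times> K\<close> and \<open>B\<close> a \<open>K \<times> J\<close> matrix; in \<open>conj_transpose I J A\<close>, \<open>A\<close> is \<open>I \<times> J\<close>.\<close>

definition matrix_mult ::
    "'i set \<Rightarrow> 'k set \<Rightarrow> 'j set \<Rightarrow> ('i, 'k) cmatrix \<Rightarrow> ('k, 'j) cmatrix \<Rightarrow> ('i, 'j) cmatrix" where
  "matrix_mult I K J A B = mk_matrix I J (\<lambda>i j. \<Sum>k\<in>K. A (i, k) * B (k, j))"

definition identity_matrix :: "'i set \<Rightarrow> ('i, 'i) cmatrix" where
  "identity_matrix I = mk_matrix I I (\<lambda>i j. if i = j then 1 else 0)"

definition conj_transpose :: "'i set \<Rightarrow> 'j set \<Rightarrow> ('i, 'j) cmatrix \<Rightarrow> ('j, 'i) cmatrix" where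
  "conj_transpose I J A = mk_matrix J I (\<lambda>j i. cnj (A (i, j)))"

text \<open>Rows and columns may be indexed by different sets, hence both products are required.\<close>

definition unitary_matrix :: "'i set \<Rightarrow> 'j set \<Rightarrow> ('i, 'j) cmatrix \<Rightarrow> bool" where
  "unitary_matrix I J U \<longleftrightarrow> U \<in> matrices I J \<and>
     matrix_mult I J I U (conj_transpose I J U) = identity_matrix I \<and>
     matrix_mult J I J (conj_transpose I J U) U = identity_matrix J"

definition complex_units :: "complex monoid" where
  "complex_units = \<lparr>carrier = - {0}, mult = (*), one = 1\<rparr>"

text \<open>Characters are extensional for the same reason as matrices.\<close>

definition character_group :: "('a, 'm) monoid_scheme \<Rightarrow> ('a \<Rightarrow> complex) monoid" where
  "character_group G =
     \<lparr>carrier = hom G complex_units \<inter> extensional (carrier G),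
      mult = (\<lambda>\<chi> \<psi>. \<lambda>a\<in>carrier G. \<chi> a * \<psi> a),
      one = (\<lambda>a\<in>carrier G. 1)\<rparr>"

abbreviation characters :: "('a, 'm) monoid_scheme \<Rightarrow> ('a \<Rightarrow> complex) set" where
  "characters G \<equiv> carrier (character_group G)"

definition normalized_character_table ::
    "('a, 'm) monoid_scheme \<Rightarrow> ('a \<Rightarrow> complex, 'a) cmatrix" where
  "normalized_character_table G =
     mk_matrix (characters G) (carrier G)
       (\<lambda>\<chi> a. 1 / complex_of_real (sqrt (real (order G))) * \<chi> a)"

definition permutation_matrix :: "'x set \<Rightarrow> 'y set \<Rightarrow> ('y \<Rightarrow> 'x) \<Rightarrow> ('x, 'y) cmatrix" where
  "permutation_matrix X Y \<pi> = mk_matrix X Y (\<lambda>x y. if x = \<pi> y then 1 else 0)"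

definition transformation_matrix ::
    "('a, 'm) monoid_scheme \<Rightarrow> ('b, 'n) monoid_scheme \<Rightarrow> ('a, 'b) cmatrix \<Rightarrow> bool" where
  "transformation_matrix G G' U \<longleftrightarrow>
     U \<in> matrices (carrier G) (carrier G') \<and>
     unitary_matrix (carrier G) (carrier G') U \<and>
     (\<forall>a\<in>carrier G. \<forall>b\<in>carrier G'. cnj (U (a, b)) = U (inv\<^bsub>G\<^esub> a, inv\<^bsub>G'\<^esub> b)) \<and>
     (\<forall>a\<in>carrier G. \<forall>b\<in>carrier G. \<forall>c\<in>carrier G'.
        U (a \<otimes>\<^bsub>G\<^esub> b, c) =
          (\<Sum>(x, y) \<in> {(x, y). x \<in> carrier G' \<and> y \<in> carrier G' \<and> x \<otimes>\<^bsub>G'\<^esub> y = c}.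
             U (a, x) * U (b, y)))"

definition character_conjugate ::
    "('a, 'm) monoid_scheme \<Rightarrow> ('b, 'n) monoid_scheme \<Rightarrow>
     (('b \<Rightarrow> complex) \<Rightarrow> ('a \<Rightarrow> complex)) \<Rightarrow> ('a, 'b) cmatrix" where
  \<comment> \<open>the product \<open>\<C>\<^sup>\<dagger> P\<^sup>\<pi> \<C>'\<close>\<close>
  "character_conjugate G G' \<pi> =
     matrix_mult (carrier G) (characters G') (carrier G')
       (matrix_mult (carrier G) (characters G) (characters G')
          (conj_transpose (characters G) (carrier G) (normalized_character_table G))
          (permutation_matrix (characters G) (characters G') \<pi>))
       (normalized_character_table G')"

lemma comm_group_complex_units: "comm_group complex_units"
  by (rule comm_groupI)
    (auto simp: complex_units_def intro!: bexI[of _ "inverse _"])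

lemma comm_group_character_group:
  assumes "comm_group G"
  shows "comm_group (character_group G)"
proof -
  interpret comm_group G by fact
  show ?thesis
  proof (rule comm_groupI)
    fix \<chi> assume \<chi>: "\<chi> \<in> characters G"
    have "(\<lambda>a\<in>carrier G. inverse (\<chi> a)) \<in> characters G"
      using \<chi> by (auto simp: character_group_def complex_units_def hom_def Pi_def)
    moreover have "(\<lambda>a\<in>carrier G. inverse (\<chi> a)) \<otimes>\<^bsub>character_group G\<^esub> \<chi>
        = \<one>\<^bsub>character_group G\<^esub>"
      using \<chi> by (auto simp: character_group_def complex_units_def hom_def Pi_def
          intro!: restrict_ext)
    ultimately show "\<exists>\<psi>\<in>characters G. \<psi> \<otimes>\<^bsub>character_group G\<^esub> \<chi> = \<one>\<^bsub>character_group G\<^esub>"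
      by blast
  next
    fix \<chi> assume \<chi>: "\<chi> \<in> characters G"
    show "\<one>\<^bsub>character_group G\<^esub> \<otimes>\<^bsub>character_group G\<^esub> \<chi> = \<chi>"
      using \<chi> by (auto simp: character_group_def extensional_def fun_eq_iff)
  qed (auto simp: character_group_def complex_units_def hom_def Pi_def mult.assoc mult.commute
      intro!: restrict_ext)
qed

lemma finite_characters:
  assumes "group G" "finite (carrier G)"
  shows "finite (characters G)"
proof -
  interpret group G by fact
  have n: "order G > 0" using assms order_gt_0_iff_finite by blast
  have pow: "\<chi> (a [^]\<^bsub>G\<^esub> (k::nat)) = \<chi> a ^ k"
    if "\<chi> \<in> characters G" "a \<in> carrier G" for \<chi> a k
  proof (induction k)
    case 0
    have "\<chi> \<one>\<^bsub>G\<^esub> * \<chi> \<one>\<^bsub>G\<^esub> = \<chi> \<one>\<^bsub>G\<^esub>" "\<chi> \<one>\<^bsub>G\<^esub> \<noteq> 0"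
      using that hom_mult[of \<chi> G complex_units "\<one>\<^bsub>G\<^esub>" "\<one>\<^bsub>G\<^esub>"]
      by (auto simp: character_group_def complex_units_def hom_def Pi_def)
    then show ?case by simp
  next
    case (Suc k)
    with that show ?case
      by (auto simp: character_group_def complex_units_def hom_def)
  qed
  have "\<chi> a ^ order G = 1" if "\<chi> \<in> characters G" "a \<in> carrier G" for \<chi> a
    using pow[OF that, of "order G"] pow[OF that, of 0] that pow_order_eq_1 by simp
  then have "characters G \<subseteq> carrier G \<rightarrow>\<^sub>E {z. z ^ order G = 1}"
    by (auto simp: PiE_def character_group_def)
  moreover have "finite {z::complex. z ^ order G = 1}"
    using n by (intro finite_roots_unity) auto
  ultimately show ?thesis
    using assms(2) by (meson finite_PiE finite_subset)
qed

end

theory Submission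
  imports Defs
begin

text \<open>Let \<open>n\<close> be the common order. A homomorphism from a subgroup to the nonzero complex numbers
  extends to one more element \<open>x\<close> by sending \<open>x\<close> to any root of the value forced on the least
  positive power of \<open>x\<close> in the subgroup. Hence characters separate points, and both orthogonality
  relations and \<open>|characters G| = n\<close> follow.

  Expanding the product, the entries of \<open>\<C>\<^sup>\<dagger> P\<^sup>\<pi> \<C>'\<close> are the averages over \<open>\<psi>\<close> of
  \<open>cnj (\<pi> \<psi> a) * \<psi> b\<close>, and the defining conditions reduce to orthogonality. Conversely, condition (3)
  says that \<open>a \<mapsto> U\<^sub>a\<close> turns products in \<open>G\<close> into convolutions over \<open>G'\<close>; so for every character
  \<open>\<psi>\<close> of \<open>G'\<close> the Fourier coefficient of the row \<open>U\<^sub>a\<close> at \<open>\<psi>\<close> is multiplicative in \<open>a\<close>.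
  Unitarity makes these functions of \<open>a\<close> nonzero and pairwise orthogonal, so their conjugates are the
  values of a bijection \<open>\<pi>\<close>, and Fourier inversion recovers \<open>U\<close>.\<close>

section \<open>Extending homomorphisms into the nonzero complex numbers\<close>

lemma ex_complex_root:
  fixes z :: complex and k :: nat
  assumes "k > 0" "z \<noteq> 0"
  obtains w where "w ^ k = z"
proof -
  have "card {w. w ^ k = z} = k"
    using assms by (intro card_nth_roots) auto
  then have "{w. w ^ k = z} \<noteq> {}"
    using assms by (metis card.empty less_irrefl)
  then show thesis
    using that by blast
qed

locale finite_comm_group = comm_group G for G :: "('a, 'm) monoid_scheme" (structure) +
  assumes finite_carrier: "finite (carrier G)"
begin

text \<open>The only relations between \<open>x\<close> and \<open>H\<close> are powers of
  \<open>x\<close> lying in \<open>H\<close>, and these are powers of \<open>x [^] k\<close>, on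
  which \<open>w\<close> is already consistent with \<open>\<chi>\<close>. The root \<open>w\<close>
  is a parameter because the two uses choose it differently: extension takes any root, separation of
  points needs one other than 1.\<close>

lemma extend_hom_adjoin:
  assumes H: "subgroup H G" and \<chi>: "\<chi> \<in> hom (G\<lparr>carrier := H\<rparr>) complex_units"
    and x: "x \<in> carrier G" and k: "k > 0" "x [^] k \<in> H"
    and least: "\<And>i. 0 < i \<Longrightarrow> i < k \<Longrightarrow> x [^] i \<notin> H"
    and w: "w ^ k = \<chi> (x [^] (k::nat))"
  obtains K \<psi> where "subgroup K G" "H \<subseteq> K" "x \<in> K"
    "\<psi> \<in> hom (G\<lparr>carrier := K\<rparr>) complex_units" "\<And>h. h \<in> H \<Longrightarrow> \<psi> h = \<chi> h" "\<psi> x = w"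
proof -
  note HG = subgroup.mem_carrier[OF H]
  note Hm = subgroup.m_closed[OF H]
  note Hi = subgroup.m_inv_closed[OF H]
  have \<chi>m: "\<chi> (g \<otimes> h) = \<chi> g * \<chi> h" if "g \<in> H" "h \<in> H" for g h
    using \<chi> that by (auto simp: hom_def complex_units_def)
  have \<chi>0: "\<chi> h \<noteq> 0" if "h \<in> H" for h
    using \<chi> that by (auto simp: hom_def complex_units_def)
  have \<chi>1: "\<chi> \<one> = 1"
    using \<chi>m[of \<one> \<one>] \<chi>0[of \<one>] subgroup.one_closed[OF H] by simp
  have w0: "w \<noteq> 0"
    using w k(1) \<chi>0[OF k(2)] by (auto simp: power_0_left)
  have Hpow: "h [^] q \<in> H \<and> \<chi> (h [^] q) = \<chi> h ^ q" if "h \<in> H" for h and q :: nat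
    using that by (induction q) (auto simp: \<chi>1 \<chi>m Hm subgroup.one_closed[OF H])
  have pow: "\<chi> (x [^] m) = w ^ m" if m: "x [^] m \<in> H" for m :: nat
  proof -
    \<comment> \<open>Division with remainder puts \<open>x [^] r\<close> into \<open>H\<close>, so
      leastness of \<open>k\<close> forces \<open>r = 0\<close>.\<close>
    define q r where "q = m div k" and "r = m mod k"
    have mqr: "m = k * q + r" and rk: "r < k"
      using k by (auto simp: q_def r_def)
    have xm: "x [^] m = (x [^] k) [^] q \<otimes> x [^] r"
      using x by (simp add: mqr nat_pow_mult nat_pow_pow)
    have "x [^] r = inv ((x [^] k) [^] q) \<otimes> x [^] m"
      unfolding xm using x by (simp add: m_assoc[symmetric])
    also have "\<dots> \<in> H"
      using Hpow[OF k(2)] m Hm Hi by blast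
    finally have "r = 0"
      using least[of r] rk by auto
    then show ?thesis
      using Hpow[OF k(2), of q] xm x mqr by (simp add: w[symmetric] power_mult)
  qed
  \<comment> \<open>the value \<open>\<chi> h * w ^ i\<close> depends only on \<open>h \<otimes> x [^] i\<close>\<close>
  have wd: "\<chi> h * w ^ i = \<chi> h' * w ^ j"
    if h: "h \<in> H" "h' \<in> H" and eq: "h \<otimes> x [^] i = h' \<otimes> x [^] j" and le: "j \<le> i"
    for h h' and i j :: nat
  proof -
    have "(h \<otimes> x [^] (i - j)) \<otimes> x [^] j = h' \<otimes> x [^] j"
      using h x le eq HG by (simp add: m_assoc nat_pow_mult)
    then have e: "h \<otimes> x [^] (i - j) = h'"
      using h x HG by simp
    then have "x [^] (i - j) = inv h \<otimes> h'"
      using h x HG by (auto simp: m_assoc[symmetric])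
    then have "x [^] (i - j) \<in> H"
      using h Hm Hi by simp
    then have "\<chi> h' = \<chi> h * w ^ (i - j)"
      using e h pow \<chi>m by metis
    then show ?thesis
      using le by (simp add: mult.assoc flip: power_add)
  qed
  \<comment> \<open>\<open>K\<close> is the subgroup generated by \<open>H\<close> and
    \<open>x\<close>; natural exponents suffice since \<open>x\<close> has finite order.\<close>
  define K where "K = {h \<otimes> x [^] i | h (i::nat). h \<in> H}"
  define \<psi> where "\<psi> y = (SOME z. \<exists>h\<in>H. \<exists>i::nat. y = h \<otimes> x [^] i \<and> z = \<chi> h * w ^ i)" for y
  have \<psi>: "\<psi> (h \<otimes> x [^] i) = \<chi> h * w ^ i" if h: "h \<in> H" for h and i :: nat
    unfolding \<psi>_def
  proof (rule some_equality)
    show "\<exists>h'\<in>H. \<exists>j. h \<otimes> x [^] i = h' \<otimes> x [^] j \<and> \<chi> h * w ^ i = \<chi> h' * w ^ j"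
      using h by blast
  qed (use wd h in \<open>metis nat_le_linear\<close>)
  have mult: "(h \<otimes> x [^] i) \<otimes> (h' \<otimes> x [^] j) = (h \<otimes> h') \<otimes> x [^] (i + j)"
    if "h \<in> H" "h' \<in> H" for h h' and i j :: nat
    using that x HG by (simp add: m_ac flip: nat_pow_mult)
  have HK: "H \<subseteq> K"
  proof
    fix h assume "h \<in> H"
    then show "h \<in> K"
      using HG by (auto simp: K_def intro!: exI[of _ h] exI[of _ "0::nat"])
  qed
  have xK: "x \<in> K"
    using x subgroup.one_closed[OF H] by (auto simp: K_def intro!: exI[of _ \<one>] exI[of _ "1::nat"])
  show thesis
  proof
    show "subgroup K G"
    proof (rule subgroupI)
      fix y assume "y \<in> K"
      then obtain h i where hi: "h \<in> H" "y = h \<otimes> x [^] (i::nat)"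
        by (auto simp: K_def)
      \<comment> \<open>This exponent stands in for \<open>-i\<close>: \<open>i + m\<close> is a
        multiple of the group order, so \<open>x [^] m\<close> is the inverse of
        \<open>x [^] i\<close>.\<close>
      define m where "m = (order G - 1) * i"
      have "order G \<ge> 1"
        using finite_carrier order_gt_0_iff_finite by (simp add: Suc_leI)
      then have "i + m = order G * i"
        by (simp add: m_def algebra_simps)
      then have "x [^] (i + m) = \<one>"
        using x pow_order_eq_1[OF x] by (simp flip: nat_pow_pow)
      then have "y \<otimes> (inv h \<otimes> x [^] m) = \<one>"
        using mult[OF hi(1) Hi[OF hi(1)], of i m] hi HG by simp
      then have "inv y = inv h \<otimes> x [^] m"
        using hi x HG by (intro inv_equality) (auto simp: m_comm)
      then show "inv y \<in> K"
        using Hi hi by (auto simp: K_def)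
    next
      fix y z assume "y \<in> K" "z \<in> K"
      then show "y \<otimes> z \<in> K"
        using mult Hm unfolding K_def by fastforce
    qed (use HK subgroup.one_closed[OF H] HG x in \<open>auto simp: K_def\<close>)
    show "\<psi> \<in> hom (G\<lparr>carrier := K\<rparr>) complex_units"
    proof (rule homI)
      fix y assume "y \<in> carrier (G\<lparr>carrier := K\<rparr>)"
      then show "\<psi> y \<in> carrier complex_units"
        using \<psi> \<chi>0 w0 by (auto simp: K_def complex_units_def)
    next
      fix y z assume "y \<in> carrier (G\<lparr>carrier := K\<rparr>)" "z \<in> carrier (G\<lparr>carrier := K\<rparr>)"
      then obtain h i h' j where "h \<in> H" "h' \<in> H"
          "y = h \<otimes> x [^] (i::nat)" "z = h' \<otimes> x [^] (j::nat)"
        by (auto simp: K_def)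
      then show "\<psi> (y \<otimes>\<^bsub>G\<lparr>carrier := K\<rparr>\<^esub> z) = \<psi> y \<otimes>\<^bsub>complex_units\<^esub> \<psi> z"
        by (simp add: mult \<psi> \<chi>m Hm complex_units_def power_add)
    qed
    show "\<psi> h = \<chi> h" if "h \<in> H" for h
      using \<psi>[OF that, of 0] HG[OF that] by simp
    show "\<psi> x = w"
      using \<psi>[OF subgroup.one_closed[OF H], of 1] x \<chi>1 by simp
  qed (fact HK xK)+
qed

lemma least_power_in_subgroup:
  assumes H: "subgroup H G" and x: "x \<in> carrier G"
  obtains k :: nat where "k > 0" "x [^] k \<in> H" "\<And>i. 0 < i \<Longrightarrow> i < k \<Longrightarrow> x [^] i \<notin> H"
proof -
  define P where "P k \<longleftrightarrow> k > 0 \<and> x [^] k \<in> H" for k :: nat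
  have "order G > 0"
    using finite_carrier order_gt_0_iff_finite by blast
  then have "P (order G)"
    using pow_order_eq_1[OF x] subgroup.one_closed[OF H] by (simp add: P_def)
  then have "P (LEAST k. P k)"
    by (rule LeastI)
  then show thesis
    using that[of "LEAST k. P k"] not_less_Least[of _ P] unfolding P_def by blast
qed

text \<open>Induction on the number of elements outside \<open>H\<close>: while one remains, it can
  be adjoined, because the required root of a nonzero complex number always exists.\<close>

lemma extend_hom_to_character:
  assumes "subgroup H G" "\<chi> \<in> hom (G\<lparr>carrier := H\<rparr>) complex_units"
  obtains \<psi> where "\<psi> \<in> characters G" "\<And>h. h \<in> H \<Longrightarrow> \<psi> h = \<chi> h"
proof -
  have "\<exists>\<psi>\<in>characters G. \<forall>h\<in>H. \<psi> h = \<chi> h"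
    using assms
  proof (induction "card (carrier G - H)" arbitrary: H \<chi> rule: less_induct)
    case less
    note H = less.prems(1)
    show ?case
    proof (cases "carrier G \<subseteq> H")
      case True
      then have "H = carrier G"
        using subgroup.subset[OF H] by blast
      then show ?thesis
        using less.prems(2)
        by (intro bexI[of _ "restrict \<chi> (carrier G)"])
           (auto simp: character_group_def hom_def Pi_def)
    next
      case False
      then obtain x where x: "x \<in> carrier G" "x \<notin> H"
        by blast
      obtain k :: nat where k: "k > 0" "x [^] k \<in> H" "\<And>i. 0 < i \<Longrightarrow> i < k \<Longrightarrow> x [^] i \<notin> H"
        using least_power_in_subgroup[OF H x(1)] by blast
      have "\<chi> (x [^] k) \<noteq> 0"
        using k(2) less.prems(2) by (auto simp: hom_def complex_units_def)
      then obtain w where "w ^ k = \<chi> (x [^] k)"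
        using ex_complex_root k(1) by blast
      then obtain K \<psi> where K: "subgroup K G" "H \<subseteq> K" "x \<in> K"
          "\<psi> \<in> hom (G\<lparr>carrier := K\<rparr>) complex_units" "\<And>h. h \<in> H \<Longrightarrow> \<psi> h = \<chi> h"
        using extend_hom_adjoin[OF less.prems x(1) k] by metis
      have "card (carrier G - K) < card (carrier G - H)"
        using K x finite_carrier by (intro psubset_card_mono) auto
      from less.hyps[OF this K(1,4)] show ?thesis
        using K(2,5) by (metis subsetD)
    qed
  qed
  then show thesis
    using that by blast
qed

text \<open>Over the trivial subgroup, the least power \<open>k\<close> is the order of
  \<open>a\<close>. It exceeds 1, so some \<open>k\<close>-th root of unity differs from 1 and may
  serve as the value at \<open>a\<close>; the homomorphism obtained then extends to all of
  \<open>G\<close>.\<close>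

lemma ex_character_neq_1:
  assumes a: "a \<in> carrier G" "a \<noteq> \<one>"
  obtains \<chi> where "\<chi> \<in> characters G" "\<chi> a \<noteq> 1"
proof -
  have H: "subgroup {\<one>} G"
    by (rule triv_subgroup)
  have \<chi>: "(\<lambda>_. 1) \<in> hom (G\<lparr>carrier := {\<one>}\<rparr>) complex_units"
    by (auto simp: hom_def complex_units_def)
  obtain k :: nat where k: "k > 0" "a [^] k \<in> {\<one>}"
      "\<And>i. 0 < i \<Longrightarrow> i < k \<Longrightarrow> a [^] i \<notin> {\<one>}"
    using least_power_in_subgroup[OF H a(1)] by blast
  have "k \<noteq> 1"
    using k(2) a by (auto simp: nat_pow_eone)
  moreover have "card {w::complex. w ^ k = 1} = k"
    using k(1) by (intro card_nth_roots) auto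
  ultimately have "{w::complex. w ^ k = 1} \<noteq> {1}"
    by force
  moreover have "(1::complex) \<in> {w. w ^ k = 1}"
    by simp
  ultimately obtain w :: complex where w: "w ^ k = 1" "w \<noteq> 1"
    by blast
  then obtain K \<psi> where "subgroup K G" "a \<in> K"
      "\<psi> \<in> hom (G\<lparr>carrier := K\<rparr>) complex_units" "\<psi> a = w"
    using extend_hom_adjoin[OF H \<chi> a(1) k] by metis
  then show thesis
    using extend_hom_to_character that w(2) by metis
qed

section \<open>Values of characters and the orthogonality relations\<close>

lemma character_mult:
  "\<chi> \<in> characters G \<Longrightarrow> a \<in> carrier G \<Longrightarrow> b \<in> carrier G \<Longrightarrow> \<chi> (a \<otimes> b) = \<chi> a * \<chi> b"
  by (auto simp: character_group_def hom_def complex_units_def)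

lemma character_nonzero: "\<chi> \<in> characters G \<Longrightarrow> a \<in> carrier G \<Longrightarrow> \<chi> a \<noteq> 0"
  by (auto simp: character_group_def hom_def complex_units_def)

lemma character_one: "\<chi> \<in> characters G \<Longrightarrow> \<chi> \<one> = 1"
  using character_mult[of \<chi> \<one> \<one>] character_nonzero[of \<chi> \<one>] by simp

text \<open>The values are roots of unity, since every element has order dividing
  \<open>order G\<close>.\<close>

lemma norm_character:
  assumes \<chi>: "\<chi> \<in> characters G" and a: "a \<in> carrier G"
  shows "norm (\<chi> a) = 1"
proof -
  have "\<chi> (a [^] k) = \<chi> a ^ k" for k :: nat
    using assms by (induction k) (simp_all add: character_one character_mult)
  from this[of "order G"] have "\<chi> a ^ order G = 1"
    using \<chi> a pow_order_eq_1 by (simp add: character_one)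
  moreover have "order G > 0"
    using finite_carrier order_gt_0_iff_finite by blast
  ultimately have "norm (\<chi> a) ^ order G = 1 ^ order G"
    by (metis norm_one norm_power power_one)
  with \<open>order G > 0\<close> show ?thesis
    by (metis norm_ge_zero power_eq_imp_eq_base zero_le_one)
qed

lemma cnj_character_mult_self:
  assumes "\<chi> \<in> characters G" "a \<in> carrier G"
  shows "cnj (\<chi> a) * \<chi> a = 1"
  using norm_character[OF assms] complex_norm_square[of "\<chi> a"] by (simp add: mult.commute)

lemma character_inv:
  assumes "\<chi> \<in> characters G" "a \<in> carrier G"
  shows "\<chi> (inv a) = cnj (\<chi> a)"
proof -
  have "\<chi> (inv a) * \<chi> a = cnj (\<chi> a) * \<chi> a"
    using assms character_mult[of \<chi> "inv a" a] by (simp add: character_one cnj_character_mult_self)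
  then show ?thesis
    using character_nonzero[OF assms] by simp
qed

lemma character_eqI:
  assumes "\<chi> \<in> characters G" "\<psi> \<in> characters G" "\<And>a. a \<in> carrier G \<Longrightarrow> \<chi> a = \<psi> a"
  shows "\<chi> = \<psi>"
  using assms by (intro extensionalityI[of _ "carrier G"]) (auto simp: character_group_def)

text \<open>If the characters differ at \<open>b\<close>, translating the summation variable by
  \<open>b\<close> multiplies the sum by \<open>cnj (\<chi> b) * \<psi> b\<close>, which is not 1;
  so the sum vanishes.\<close>

lemma character_row_orthogonality:
  assumes \<chi>: "\<chi> \<in> characters G" and \<psi>: "\<psi> \<in> characters G"
  shows "(\<Sum>a\<in>carrier G. cnj (\<chi> a) * \<psi> a) = (if \<chi> = \<psi> then of_nat (order G) else 0)"
proof (cases "\<chi> = \<psi>")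
  case True
  then show ?thesis
    using \<psi> by (simp add: cnj_character_mult_self order_def)
next
  case False
  then obtain b where b: "b \<in> carrier G" "\<chi> b \<noteq> \<psi> b"
    using character_eqI assms by blast
  let ?S = "\<Sum>a\<in>carrier G. cnj (\<chi> a) * \<psi> a"
  have "?S = (\<Sum>a\<in>carrier G. cnj (\<chi> (b \<otimes> a)) * \<psi> (b \<otimes> a))"
    by (rule sum.reindex_bij_witness[where i = "\<lambda>a. b \<otimes> a" and j = "\<lambda>a. inv b \<otimes> a"])
       (use b in \<open>auto simp: m_assoc[symmetric]\<close>)
  also have "\<dots> = cnj (\<chi> b) * \<psi> b * ?S"
    using assms b by (simp add: character_mult sum_distrib_left mult_ac)
  finally have "?S = 0 \<or> cnj (\<chi> b) * \<psi> b = 1"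
    by (metis mult_cancel_right1)
  moreover have "cnj (\<chi> b) * \<psi> b \<noteq> cnj (\<chi> b) * \<chi> b"
    using b character_nonzero[OF \<chi> b(1)] by simp
  ultimately show ?thesis
    using False cnj_character_mult_self[OF \<chi> b(1)] by simp
qed

text \<open>The same translation argument in the dual group: multiplying all characters by some
  \<open>\<phi>\<close> with \<open>\<phi> a \<noteq> 1\<close> permutes them and scales the sum by
  \<open>\<phi> a\<close>.\<close>

lemma sum_characters:
  assumes a: "a \<in> carrier G" "a \<noteq> \<one>"
  shows "(\<Sum>\<chi>\<in>characters G. \<chi> a) = 0"
proof -
  interpret C: comm_group "character_group G"
    by (rule comm_group_character_group) (rule comm_group_axioms)
  obtain \<phi> where \<phi>: "\<phi> \<in> characters G" "\<phi> a \<noteq> 1"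
    using ex_character_neq_1[OF a] .
  let ?S = "\<Sum>\<chi>\<in>characters G. \<chi> a"
  have "?S = (\<Sum>\<chi>\<in>characters G. (\<phi> \<otimes>\<^bsub>character_group G\<^esub> \<chi>) a)"
    by (rule sum.reindex_bij_witness[where i = "\<lambda>\<chi>. \<phi> \<otimes>\<^bsub>character_group G\<^esub> \<chi>"
          and j = "\<lambda>\<chi>. inv\<^bsub>character_group G\<^esub> \<phi> \<otimes>\<^bsub>character_group G\<^esub> \<chi>"])
       (use \<phi>(1) in \<open>auto simp: C.m_assoc[symmetric]\<close>)
  also have "\<dots> = \<phi> a * ?S"
    using a by (simp add: character_group_def sum_distrib_left)
  finally show ?thesis
    using \<phi>(2) by (metis mult_cancel_right1)
qed

text \<open>The sum of \<open>\<chi> a\<close> over all pairs is computed in both orders. Summing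
  over \<open>a\<close> first leaves only the trivial character and gives \<open>order G\<close>;
  summing over \<open>\<chi>\<close> first leaves only \<open>\<one>\<close> and gives the number of
  characters.\<close>

lemma card_characters: "card (characters G) = order G"
proof -
  let ?one = "\<one>\<^bsub>character_group G\<^esub>"
  have fin: "finite (characters G)"
    using finite_characters finite_carrier is_group by blast
  have one: "?one \<in> characters G"
    by (rule monoid.one_closed)
       (simp add: comm_group_character_group comm_group.axioms(2) comm_group_axioms group.is_monoid)
  have "(\<Sum>a\<in>carrier G. \<chi> a) = (if \<chi> = ?one then of_nat (order G) else 0)"
    if "\<chi> \<in> characters G" for \<chi>
    using character_row_orthogonality[OF one that]
    by (auto simp: character_group_def cong: sum.cong)
  then have "(\<Sum>\<chi>\<in>characters G. \<Sum>a\<in>carrier G. \<chi> a) = of_nat (order G)"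
    using fin one by (simp add: sum.delta cong: sum.cong)
  moreover have "(\<Sum>\<chi>\<in>characters G. \<chi> a) =
      (if a = \<one> then of_nat (card (characters G)) else 0)" if "a \<in> carrier G" for a
    using sum_characters[OF that] by (simp add: character_one)
  then have "(\<Sum>a\<in>carrier G. \<Sum>\<chi>\<in>characters G. \<chi> a) = of_nat (card (characters G))"
    using finite_carrier by (simp add: sum.delta cong: sum.cong)
  ultimately have "(of_nat (card (characters G)) :: complex) = of_nat (order G)"
    using sum.swap[of "\<lambda>\<chi> a. \<chi> a" "carrier G" "characters G"] by simp
  then show ?thesis
    by (simp only: of_nat_eq_iff)
qed

lemma character_column_orthogonality:
  assumes a: "a \<in> carrier G" and b: "b \<in> carrier G"
  shows "(\<Sum>\<chi>\<in>characters G. cnj (\<chi> a) * \<chi> b) = (if a = b then of_nat (order G) else 0)"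
proof (cases "a = b")
  case True
  then show ?thesis
    using b by (simp add: cnj_character_mult_self card_characters)
next
  case False
  then have "inv a \<otimes> b \<noteq> \<one>"
    using a b by (metis inv_equality inv_inv inv_closed)
  moreover have "cnj (\<chi> a) * \<chi> b = \<chi> (inv a \<otimes> b)" if "\<chi> \<in> characters G" for \<chi>
    using that a b by (simp add: character_mult character_inv)
  ultimately show ?thesis
    using sum_characters[of "inv a \<otimes> b"] a b False by simp
qed

text \<open>Turns the sum over pairs in condition (3) into a convolution over a single
  variable.\<close>

lemma sum_factorisations:
  assumes c: "c \<in> carrier G"
  shows "(\<Sum>(x, y) \<in> {(x, y). x \<in> carrier G \<and> y \<in> carrier G \<and> x \<otimes> y = c}. f x y) =
         (\<Sum>x\<in>carrier G. f x (inv x \<otimes> c))"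
  by (rule sum.reindex_bij_witness[where i = "\<lambda>x. (x, inv x \<otimes> c)" and j = fst])
     (use c in \<open>auto simp: m_assoc[symmetric]\<close>)

end

section \<open>Every bijection of the duals yields a transformation matrix\<close>

locale two_finite_comm_groups =
  G: finite_comm_group G + G': finite_comm_group G'
  for G :: "('a, 'm) monoid_scheme" and G' :: "('b, 'n) monoid_scheme" +
  assumes order_eq: "order G = order G'"
begin

abbreviation n :: complex where "n \<equiv> of_nat (order G)"

lemma n_nonzero: "n \<noteq> 0"
  using G.finite_carrier G.order_gt_0_iff_finite by (metis less_irrefl of_nat_eq_0_iff)

lemma finite_dual: "finite (characters G)" "finite (characters G')"
  using finite_characters G.is_group G.finite_carrier G'.is_group G'.finite_carrier by blast+

lemma unitary_matrix_iff:
  "unitary_matrix (carrier G) (carrier G') U \<longleftrightarrow> U \<in> matrices (carrier G) (carrier G') \<and>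
     (\<forall>a\<in>carrier G. \<forall>a'\<in>carrier G.
        (\<Sum>b\<in>carrier G'. U (a, b) * cnj (U (a', b))) = (if a = a' then 1 else 0)) \<and>
     (\<forall>b\<in>carrier G'. \<forall>b'\<in>carrier G'.
        (\<Sum>a\<in>carrier G. cnj (U (a, b)) * U (a, b')) = (if b = b' then 1 else 0))"
proof -
  have mk_eq: "mk_matrix I J f = mk_matrix I J g \<longleftrightarrow> (\<forall>i\<in>I. \<forall>j\<in>J. f i j = g i j)"
    for I :: "'i set" and J :: "'j set" and f g
    by (auto simp: mk_matrix_def restrict_def fun_eq_iff split: if_splits)
  show ?thesis
    unfolding unitary_matrix_def matrix_mult_def identity_matrix_def mk_eq
    by (simp add: conj_transpose_def mk_matrix_def cong: sum.cong)
qed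

text \<open>The permutation matrix leaves only \<open>\<chi> = \<pi> \<psi>\<close> in the inner
  sum, and the two normalising square roots combine to \<open>n\<close> because the orders
  agree.\<close>

lemma character_conjugate_apply:
  assumes \<pi>: "\<pi> \<in> characters G' \<rightarrow> characters G" and ab: "a \<in> carrier G" "b \<in> carrier G'"
  shows "character_conjugate G G' \<pi> (a, b) = (\<Sum>\<psi>\<in>characters G'. cnj (\<pi> \<psi> a) * \<psi> b) / n"
proof -
  define s where "s = complex_of_real (sqrt (real (order G)))"
  have s: "s * s = n" "cnj s = s"
    by (simp_all add: s_def flip: of_real_mult)
  have "(\<Sum>\<chi>\<in>characters G. cnj (\<chi> a) / s * (if \<chi> = \<pi> \<psi> then 1 else 0)) = cnj (\<pi> \<psi> a) / s"
    if "\<psi> \<in> characters G'" for \<psi>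
  proof -
    have "\<pi> \<psi> \<in> characters G"
      using \<pi> that by blast
    then show ?thesis
      using finite_dual by (simp add: if_distrib sum.delta cong: if_cong)
  qed
  then show ?thesis
    using ab s by (simp add: character_conjugate_def matrix_mult_def mk_matrix_def
        conj_transpose_def normalized_character_table_def permutation_matrix_def
        order_eq[symmetric] s_def[symmetric] sum_divide_distrib cong: sum.cong)
qed

lemma character_conjugate_in_matrices:
  "character_conjugate G G' \<pi> \<in> matrices (carrier G) (carrier G')"
  by (auto simp: character_conjugate_def matrix_mult_def mk_matrix_def matrices_def)

text \<open>Under convolution over \<open>G'\<close>, distinct characters annihilate each other and
  each character reproduces itself up to the factor \<open>n\<close>. Condition (3) therefore holds
  for any map \<open>\<pi>\<close> into the characters, bijective or not.\<close>

lemma character_conjugate_convolution: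
  assumes \<pi>: "\<pi> \<in> characters G' \<rightarrow> characters G"
    and a: "a \<in> carrier G" "a' \<in> carrier G"
    and z: "z \<in> carrier G'"
  shows "(\<Sum>x\<in>carrier G'. character_conjugate G G' \<pi> (a, x) *
            character_conjugate G G' \<pi> (a', inv\<^bsub>G'\<^esub> x \<otimes>\<^bsub>G'\<^esub> z)) =
         character_conjugate G G' \<pi> (a \<otimes>\<^bsub>G\<^esub> a', z)"
proof -
  let ?X = "characters G'"
  have \<pi>X: "\<pi> \<psi> \<in> characters G" if "\<psi> \<in> ?X" for \<psi>
    using \<pi> that by blast
  have "(\<Sum>x\<in>carrier G'. character_conjugate G G' \<pi> (a, x) *
            character_conjugate G G' \<pi> (a', inv\<^bsub>G'\<^esub> x \<otimes>\<^bsub>G'\<^esub> z)) =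
      (\<Sum>x\<in>carrier G'. \<Sum>\<psi>\<in>?X. \<Sum>\<phi>\<in>?X.
         cnj (\<pi> \<psi> a) * cnj (\<pi> \<phi> a') * \<phi> z / (n * n) * (cnj (\<phi> x) * \<psi> x))"
    using a z by (intro sum.cong)
      (simp_all add: character_conjugate_apply[OF \<pi>] sum_product sum_divide_distrib
        G'.character_mult G'.character_inv mult_ac cong: sum.cong)
  also have "\<dots> = (\<Sum>\<psi>\<in>?X. \<Sum>\<phi>\<in>?X. cnj (\<pi> \<psi> a) * cnj (\<pi> \<phi> a') * \<phi> z / (n * n) *
         (\<Sum>x\<in>carrier G'. cnj (\<phi> x) * \<psi> x))"
    by (simp add: sum_distrib_left sum.swap[of _ "carrier G'"])
  also have "\<dots> = (\<Sum>\<psi>\<in>?X. cnj (\<pi> \<psi> a) * cnj (\<pi> \<psi> a') * \<psi> z / n)"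
    using n_nonzero finite_dual
    by (simp add: G'.character_row_orthogonality order_eq[symmetric] if_distrib sum.delta'
        cong: sum.cong if_cong)
  also have "\<dots> = character_conjugate G G' \<pi> (a \<otimes>\<^bsub>G\<^esub> a', z)"
    using a z by (simp add: character_conjugate_apply[OF \<pi>] sum_divide_distrib
        G.character_mult[OF \<pi>X] cong: sum.cong)
  finally show ?thesis .
qed

lemma character_conjugate_cnj:
  assumes \<pi>: "\<pi> \<in> characters G' \<rightarrow> characters G" and ab: "a \<in> carrier G" "b \<in> carrier G'"
  shows "cnj (character_conjugate G G' \<pi> (a, b)) =
    character_conjugate G G' \<pi> (inv\<^bsub>G\<^esub> a, inv\<^bsub>G'\<^esub> b)"
proof -
  have "\<pi> \<psi> \<in> characters G" if "\<psi> \<in> characters G'" for \<psi>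
    using \<pi> that by blast
  then show ?thesis
    using ab by (simp add: character_conjugate_apply[OF \<pi>] G.character_inv G'.character_inv
        cong: sum.cong)
qed

lemma transformation_matrix_character_conjugate:
  assumes bij: "bij_betw \<pi> (characters G') (characters G)"
  shows "transformation_matrix G G' (character_conjugate G G' \<pi>)"
proof -
  let ?U = "character_conjugate G G' \<pi>"
  let ?X = "characters G'"
  have \<pi>: "\<pi> \<in> ?X \<rightarrow> characters G"
    using bij by (auto simp: bij_betw_def)
  then have \<pi>X: "\<pi> \<psi> \<in> characters G" if "\<psi> \<in> ?X" for \<psi>
    using that by blast
  have inj: "\<pi> \<psi> = \<pi> \<phi> \<longleftrightarrow> \<psi> = \<phi>" if "\<psi> \<in> ?X" "\<phi> \<in> ?X" for \<psi> \<phi>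
    using bij that by (auto simp: bij_betw_def inj_on_def)
  have rows: "(\<Sum>b\<in>carrier G'. ?U (a, b) * cnj (?U (a', b))) = (if a = a' then 1 else 0)"
    if a: "a \<in> carrier G" "a' \<in> carrier G" for a a'
  proof -
    let ?e = "a \<otimes>\<^bsub>G\<^esub> inv\<^bsub>G\<^esub> a'"
    \<comment> \<open>Conjugation inverts both indices, so the inner product of two rows is a
      convolution evaluated at the identity of \<open>G'\<close>.\<close>
    have "(\<Sum>b\<in>carrier G'. ?U (a, b) * cnj (?U (a', b))) = ?U (?e, \<one>\<^bsub>G'\<^esub>)"
      using a character_conjugate_convolution[OF \<pi>, of a "inv\<^bsub>G\<^esub> a'" "\<one>\<^bsub>G'\<^esub>"]
      by (simp add: character_conjugate_cnj[OF \<pi>] cong: sum.cong)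
    also have "\<dots> = (\<Sum>\<psi>\<in>?X. cnj (\<pi> \<psi> a) * \<pi> \<psi> a') / n"
      using a by (simp add: character_conjugate_apply[OF \<pi>] G'.character_one
          G.character_mult[OF \<pi>X] G.character_inv[OF \<pi>X] cong: sum.cong)
    also have "\<dots> = (\<Sum>\<chi>\<in>characters G. cnj (\<chi> a) * \<chi> a') / n"
      using sum.reindex_bij_betw[OF bij, of "\<lambda>\<chi>. cnj (\<chi> a) * \<chi> a'"] by simp
    also have "\<dots> = (if a = a' then 1 else 0)"
      using a n_nonzero by (simp add: G.character_column_orthogonality)
    finally show ?thesis .
  qed
  have cols: "(\<Sum>a\<in>carrier G. cnj (?U (a, b)) * ?U (a, b')) = (if b = b' then 1 else 0)"
    if b: "b \<in> carrier G'" "b' \<in> carrier G'" for b b'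
  proof -
    have "(\<Sum>a\<in>carrier G. cnj (?U (a, b)) * ?U (a, b')) =
        (\<Sum>a\<in>carrier G. \<Sum>\<psi>\<in>?X. \<Sum>\<phi>\<in>?X.
           \<psi> b' * cnj (\<phi> b) / (n * n) * (cnj (\<pi> \<psi> a) * \<pi> \<phi> a))"
      using b by (intro sum.cong)
        (simp_all add: character_conjugate_apply[OF \<pi>] sum_product sum_divide_distrib mult_ac)
    also have "\<dots> = (\<Sum>\<psi>\<in>?X. \<Sum>\<phi>\<in>?X. \<psi> b' * cnj (\<phi> b) / (n * n) *
           (\<Sum>a\<in>carrier G. cnj (\<pi> \<psi> a) * \<pi> \<phi> a))"
      by (simp add: sum_distrib_left sum.swap[of _ "carrier G"])
    \<comment> \<open>Injectivity of \<open>\<pi>\<close> enters here: orthogonality in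
      \<open>G\<close> leaves exactly the diagonal terms.\<close>
    also have "\<dots> = (\<Sum>\<psi>\<in>?X. \<psi> b' * cnj (\<psi> b)) / n"
      using n_nonzero finite_dual
      by (simp add: G.character_row_orthogonality[OF \<pi>X \<pi>X] inj if_distrib sum.delta
          sum_divide_distrib cong: sum.cong if_cong)
    also have "\<dots> = (if b = b' then 1 else 0)"
      using b n_nonzero G'.character_column_orthogonality[OF b]
      by (simp add: order_eq mult.commute)
    finally show ?thesis .
  qed
  show ?thesis
    unfolding transformation_matrix_def unitary_matrix_iff
    using rows cols character_conjugate_in_matrices character_conjugate_cnj[OF \<pi>]
    by (simp add: G'.sum_factorisations character_conjugate_convolution[OF \<pi>])
qed

section \<open>Every transformation matrix comes from a bijection of the duals\<close>

context
  fixes U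
  assumes U: "transformation_matrix G G' U"
begin

text \<open>The unnormalised Fourier coefficient at \<open>\<psi>\<close> of row \<open>a\<close>;
  as a function of \<open>a\<close>, it is \<open>U\<close> applied to the conjugate of
  \<open>\<psi>\<close>.\<close>

definition row_transform :: "('b \<Rightarrow> complex) \<Rightarrow> 'a \<Rightarrow> complex" where
  "row_transform \<psi> a = (\<Sum>x\<in>carrier G'. U (a, x) * cnj (\<psi> x))"

text \<open>This is the convolution theorem: condition (3) makes row \<open>a \<otimes> b\<close>
  the convolution of rows \<open>a\<close> and \<open>b\<close>, and Fourier coefficients turn
  convolution into multiplication.\<close>

lemma row_transform_mult:
  assumes \<psi>: "\<psi> \<in> characters G'" and ab: "a \<in> carrier G" "b \<in> carrier G"
  shows "row_transform \<psi> (a \<otimes>\<^bsub>G\<^esub> b) = row_transform \<psi> a * row_transform \<psi> b"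
proof -
  have "row_transform \<psi> (a \<otimes>\<^bsub>G\<^esub> b) =
      (\<Sum>c\<in>carrier G'. \<Sum>x\<in>carrier G'. U (a, x) * U (b, inv\<^bsub>G'\<^esub> x \<otimes>\<^bsub>G'\<^esub> c) * cnj (\<psi> c))"
    using U ab unfolding row_transform_def transformation_matrix_def
    by (simp add: G'.sum_factorisations sum_distrib_right cong: sum.cong)
  also have "\<dots> =
      (\<Sum>x\<in>carrier G'. \<Sum>c\<in>carrier G'. U (a, x) * U (b, inv\<^bsub>G'\<^esub> x \<otimes>\<^bsub>G'\<^esub> c) * cnj (\<psi> c))"
    by (rule sum.swap)
  also have "\<dots> =
      (\<Sum>x\<in>carrier G'. \<Sum>y\<in>carrier G'. U (a, x) * U (b, y) * cnj (\<psi> (x \<otimes>\<^bsub>G'\<^esub> y)))"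
  proof (rule sum.cong[OF refl])
    fix x assume "x \<in> carrier G'"
    then show "(\<Sum>c\<in>carrier G'. U (a, x) * U (b, inv\<^bsub>G'\<^esub> x \<otimes>\<^bsub>G'\<^esub> c) * cnj (\<psi> c)) =
        (\<Sum>y\<in>carrier G'. U (a, x) * U (b, y) * cnj (\<psi> (x \<otimes>\<^bsub>G'\<^esub> y)))"
      by (intro sum.reindex_bij_witness[where i = "\<lambda>y. x \<otimes>\<^bsub>G'\<^esub> y"
            and j = "\<lambda>c. inv\<^bsub>G'\<^esub> x \<otimes>\<^bsub>G'\<^esub> c"])
         (auto simp: G'.m_assoc[symmetric])
  qed
  also have "\<dots> = row_transform \<psi> a * row_transform \<psi> b"
    using \<psi> unfolding row_transform_def
    by (simp add: sum_product G'.character_mult mult_ac cong: sum.cong)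
  finally show ?thesis .
qed

text \<open>Orthonormal columns make \<open>U\<close> an isometry, so the orthogonality of the
  characters of \<open>G'\<close> is carried over to functions on \<open>G\<close>.\<close>

lemma row_transform_inner:
  assumes \<psi>: "\<psi> \<in> characters G'" and \<phi>: "\<phi> \<in> characters G'"
  shows "(\<Sum>a\<in>carrier G. cnj (row_transform \<psi> a) * row_transform \<phi> a) = (if \<psi> = \<phi> then n else 0)"
proof -
  have cols: "(\<Sum>a\<in>carrier G. cnj (U (a, x)) * U (a, y)) = (if x = y then 1 else 0)"
    if "x \<in> carrier G'" "y \<in> carrier G'" for x y
    using U that unfolding transformation_matrix_def unitary_matrix_iff by blast
  have "(\<Sum>a\<in>carrier G. cnj (row_transform \<psi> a) * row_transform \<phi> a) =
      (\<Sum>a\<in>carrier G. \<Sum>x\<in>carrier G'. \<Sum>y\<in>carrier G'.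
         \<psi> x * cnj (\<phi> y) * (cnj (U (a, x)) * U (a, y)))"
    by (simp add: row_transform_def sum_product mult_ac)
  also have "\<dots> = (\<Sum>x\<in>carrier G'. \<Sum>y\<in>carrier G'. \<psi> x * cnj (\<phi> y) *
         (\<Sum>a\<in>carrier G. cnj (U (a, x)) * U (a, y)))"
    by (simp add: sum_distrib_left sum.swap[of _ "carrier G"])
  also have "\<dots> = (\<Sum>x\<in>carrier G'. \<psi> x * cnj (\<phi> x))"
    using G'.finite_carrier
    by (simp add: cols if_distrib sum.delta cong: sum.cong if_cong)
  also have "\<dots> = (if \<psi> = \<phi> then n else 0)"
    using G'.character_row_orthogonality[OF \<phi> \<psi>] by (auto simp: order_eq mult.commute)
  finally show ?thesis .
qed

text \<open>By multiplicativity, a single zero would spread to all of \<open>G\<close>,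
  contradicting the squared norm \<open>n\<close>.\<close>

lemma row_transform_nonzero:
  assumes \<psi>: "\<psi> \<in> characters G'" and a: "a \<in> carrier G"
  shows "row_transform \<psi> a \<noteq> 0"
proof
  assume 0: "row_transform \<psi> a = 0"
  have "row_transform \<psi> b = 0" if b: "b \<in> carrier G" for b
  proof -
    have "a \<otimes>\<^bsub>G\<^esub> (inv\<^bsub>G\<^esub> a \<otimes>\<^bsub>G\<^esub> b) = b"
      using a b by (simp add: G.m_assoc[symmetric])
    then show ?thesis
      using row_transform_mult[OF \<psi> a, of "inv\<^bsub>G\<^esub> a \<otimes>\<^bsub>G\<^esub> b"] 0 a b by simp
  qed
  then show False
    using row_transform_inner[OF \<psi> \<psi>] n_nonzero by simp
qed

text \<open>The conjugate cancels the one that the conjugate transpose puts on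
  \<open>\<pi> \<psi> a\<close> in the entries of the product.\<close>

definition dual_map :: "('b \<Rightarrow> complex) \<Rightarrow> 'a \<Rightarrow> complex" where
  "dual_map \<psi> = (\<lambda>a\<in>carrier G. cnj (row_transform \<psi> a))"

lemma dual_map_character: "\<psi> \<in> characters G' \<Longrightarrow> dual_map \<psi> \<in> characters G"
  by (auto simp: character_group_def[of G] hom_def complex_units_def dual_map_def
      row_transform_mult row_transform_nonzero)

text \<open>Distinct characters have orthogonal nonzero images, which gives injectivity;
  surjectivity follows by counting, as both duals have the common order as cardinality.\<close>

lemma bij_betw_dual_map: "bij_betw dual_map (characters G') (characters G)"
proof -
  have inj: "inj_on dual_map (characters G')"
  proof
    fix \<psi> \<phi> assume \<psi>: "\<psi> \<in> characters G'" and \<phi>: "\<phi> \<in> characters G'" and eq: "dual_map \<psi> = dual_map \<phi>"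
    have "row_transform \<psi> a = row_transform \<phi> a" if "a \<in> carrier G" for a
      using fun_cong[OF eq, of a] that by (simp add: dual_map_def)
    then have "(if \<psi> = \<phi> then n else 0) = n"
      using row_transform_inner[OF \<psi> \<phi>] row_transform_inner[OF \<phi> \<phi>] by (simp cong: sum.cong)
    then show "\<psi> = \<phi>"
      using n_nonzero by (metis (full_types))
  qed
  moreover have "dual_map ` characters G' = characters G"
    using dual_map_character inj finite_dual
    by (intro card_subset_eq) (auto simp: card_image G.card_characters G'.card_characters order_eq)
  ultimately show ?thesis
    by (simp add: bij_betw_def)
qed

text \<open>Fourier inversion on each row: column orthogonality in \<open>G'\<close> isolates the
  term \<open>x = b\<close>.\<close>

lemma eq_character_conjugate_dual_map: "U = character_conjugate G G' dual_map"
proof -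
  have \<pi>: "dual_map \<in> characters G' \<rightarrow> characters G"
    using dual_map_character by blast
  have "U (a, b) = character_conjugate G G' dual_map (a, b)"
    if ab: "a \<in> carrier G" "b \<in> carrier G'" for a b
  proof -
    have "character_conjugate G G' dual_map (a, b) =
        (\<Sum>\<psi>\<in>characters G'. \<Sum>x\<in>carrier G'. U (a, x) * (cnj (\<psi> x) * \<psi> b)) / n"
      using ab by (simp add: character_conjugate_apply[OF \<pi>] dual_map_def row_transform_def
          sum_distrib_right mult.assoc)
    also have "\<dots> = (\<Sum>x\<in>carrier G'. U (a, x) * (\<Sum>\<psi>\<in>characters G'. cnj (\<psi> x) * \<psi> b)) / n"
      by (simp add: sum_distrib_left sum.swap[of _ "characters G'"])
    also have "\<dots> = U (a, b)"
      using ab n_nonzero G'.finite_carrier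
      by (simp add: G'.character_column_orthogonality order_eq if_distrib sum.delta'
          cong: sum.cong if_cong)
    finally show ?thesis
      by simp
  qed
  moreover have "U \<in> matrices (carrier G) (carrier G')"
    using U by (simp add: transformation_matrix_def)
  ultimately show ?thesis
    using PiE_ext[of U "carrier G \<times> carrier G'" "\<lambda>_. UNIV" "character_conjugate G G' dual_map"]
      character_conjugate_in_matrices[of dual_map] unfolding matrices_def by auto
qed

end

end

theorem theorem9p1:
  fixes G :: "('a, 'm) monoid_scheme" and G' :: "('b, 'n) monoid_scheme"
  assumes "comm_group G" and "finite (carrier G)"
    and "comm_group G'" and "finite (carrier G')"
    and "order G = order G'"
  shows "{U. transformation_matrix G G' U} =
           {character_conjugate G G' \<pi> | \<pi>. bij_betw \<pi> (characters G') (characters G)} \<and>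
         finite {U. transformation_matrix G G' U}"
proof -
  interpret two_finite_comm_groups G G'
    using assms by (simp add: two_finite_comm_groups_def two_finite_comm_groups_axioms_def
        finite_comm_group_def finite_comm_group_axioms_def)
  let ?B = "{character_conjugate G G' \<pi> | \<pi>. bij_betw \<pi> (characters G') (characters G)}"
  have eq: "{U. transformation_matrix G G' U} = ?B"
    using transformation_matrix_character_conjugate bij_betw_dual_map eq_character_conjugate_dual_map
    by fast
  \<comment> \<open>The bijections \<open>\<pi>\<close> are arbitrary outside
    \<open>characters G'\<close>, so finiteness is not immediate. The product depends only on the
    restriction of \<open>\<pi>\<close>, and there are finitely many extensional maps.\<close>
  have "?B \<subseteq> character_conjugate G G' ` (characters G' \<rightarrow>\<^sub>E characters G)"
  proof
    fix U assume "U \<in> ?B"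
    then obtain \<pi> where \<pi>: "bij_betw \<pi> (characters G') (characters G)"
        and U: "U = character_conjugate G G' \<pi>"
      by blast
    have "permutation_matrix (characters G) (characters G') \<pi> =
        permutation_matrix (characters G) (characters G') (restrict \<pi> (characters G'))"
      by (auto simp: permutation_matrix_def mk_matrix_def intro!: restrict_ext)
    then have "U = character_conjugate G G' (restrict \<pi> (characters G'))"
      by (simp add: U character_conjugate_def)
    moreover have "restrict \<pi> (characters G') \<in> characters G' \<rightarrow>\<^sub>E characters G"
      using \<pi> by (auto simp: bij_betw_def)
    ultimately show "U \<in> character_conjugate G G' ` (characters G' \<rightarrow>\<^sub>E characters G)"
      by blast
  qed
  then have "finite ?B"
    using finite_dual by (meson finite_PiE finite_imageI finite_subset)
  with eq show ?thesis
    by simp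
qed

end
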